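(* Let $A=\mathbb{F}_q[t]$, where $q$ is a power of an odd prime $p$. Let $\wp\in A$ be a monic irreducible polynomial of degree $d$, and let $\theta\in\mathbb{F}_{q^d}$ be a root of $\wp$. Write $\wp'=d\wp/dt$. Then each of the following conditions is equivalent to $\wp$ being a Wilson prime, i.e. to $F_d\equiv -1\pmod{\wp^2}$ (equivalently, to $d^2\wp/dt^2=0$): (i-ii) $dQ_{\wp}(t)/dt\equiv 0\pmod{\wp}$; (i-ii') $(dQ_{\wp}(t)/dt)|_{t=\theta}=0$; (ii-i) $Q_{\wp}(\wp')\equiv 0\pmod{\wp}$; (ii-i') $Q_{\wp}(\wp')|_{t=\theta}=0$; (i-iii) $(d\wp^{[1]}/dt)|_{t=\theta}=0$; (iii-i) $(\wp')^{[1]}|_{t=\theta}=0$; (ii-iii) $Q_{\wp}(\wp^{[1]})|_{t=\theta}=0$; (iii-ii) $(Q_{\wp}(t))^{[1]}|_{t=\theta}=0$.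
   Context: $F_d$ denotes the product of all nonzero polynomials in $A$ of degree less than $d$. For $a\in\mathbb{F}_{q^d}[t]$, the Fermat quotient is $Q_{\wp}(a):=(a^{q^d}-a)/\wp\in\mathbb{F}_{q^d}[t]$ (a polynomial since $\wp\mid t^{q^d}-t$), and the difference quotient is $a^{[1]}(t):=(a(t)-a(\theta))/(t-\theta)\in\mathbb{F}_{q^d}[t]$. Congruences modulo $\wp$ are divisibility in $\mathbb{F}_{q^d}[t]$. *)

theory Defs
  imports
    "HOL-Computational_Algebra.Computational_Algebra"
    "HOL-Number_Theory.Cong"
    "HOL-Library.Cardinality"
begin

(* The finite fields F_q and F_(q^d) are the types 'a and 'k; F_q[t] is 'a poly and
   F_(q^d)[t] is 'k poly. A field homomorphism \<iota> :: 'a \<Rightarrow> 'k embeds the first field in the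
   second, and map_poly \<iota> is the resulting inclusion of F_q[t] in F_(q^d)[t]. *)

definition prod_nonzero_polys :: "nat \<Rightarrow> 'a::{field,finite} poly" where
  "prod_nonzero_polys d = \<Prod>{f. f \<noteq> 0 \<and> degree f < d}"

definition wilson_prime :: "'a::{field,finite} poly \<Rightarrow> bool" where
  "wilson_prime P \<longleftrightarrow> lead_coeff P = 1 \<and> irreducible P \<and>
     [prod_nonzero_polys (degree P) = -1] (mod P ^ 2)"

(* With d = degree P, the polynomial P divides t^(q^d) - t and hence a^(q^d) - a whenever
   CARD('k) = q^d, so in that situation the division below is exact. *)
definition fermat_quotient ::
  "('a::{field,finite} \<Rightarrow> 'k::{field,finite}) \<Rightarrow> 'a poly \<Rightarrow> 'k poly \<Rightarrow> 'k poly" where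
  "fermat_quotient \<iota> P a = (a ^ (CARD('a) ^ degree P) - a) div map_poly \<iota> P"

(* (a(t) - a(\<theta>)) / (t - \<theta>); the division is always exact. *)
definition difference_quotient :: "'k::field \<Rightarrow> 'k poly \<Rightarrow> 'k poly" where
  "difference_quotient \<theta> a = (a - [:poly a \<theta>:]) div [:-\<theta>, 1:]"

end

theory Submission
  imports Defs
begin

text \<open>Every condition turns out to be equivalent to \<open>\<wp>''(\<theta>) = 0\<close>, and \<open>\<wp>'(\<theta>) \<noteq> 0\<close>.
  With \<open>T = t ^ (q ^ d) - t = \<wp> R\<close>, every \<open>a\<close> over the large field satisfies
  \<open>a ^ (q ^ d) = a(t + T) \<equiv> a + a' T\<close> modulo \<open>T ^ 2\<close>, so the Fermat quotient of \<open>a\<close> takes the value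
  \<open>a'(\<theta>) R(\<theta>)\<close> at \<open>\<theta>\<close>. For the Wilson condition, evaluation at \<open>\<theta>\<close> maps the polynomials of degree less
  than \<open>d\<close> over the small field bijectively to the large field. Hence \<open>F\<^sub>d(\<theta>) = -1\<close>, and
  \<open>F\<^sub>d + 1\<close> is divisible by \<open>\<wp> ^ 2\<close> iff the sum of \<open>a'(\<theta>) / a(\<theta>)\<close> over all such \<open>a \<noteq> 0\<close> vanishes.
  Lagrange interpolation at the conjugates of \<open>\<theta>\<close> writes \<open>a'(\<theta>)\<close> as a combination of the powers
  \<open>a(\<theta>) ^ (q ^ i)\<close>, and evaluating power sums shows that the sum is \<open>-\<wp>''(\<theta>) / (2 \<wp>'(\<theta>))\<close>.\<close>

section \<open>Finite fields\<close>

text \<open>Multiplication by \<open>x \<noteq> 0\<close> permutes the nonzero elements, so it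
  leaves their product unchanged.\<close>

lemma power_CARD_eq_self:
  fixes x :: "'k::{field,finite}"
  shows "x ^ CARD('k) = x"
proof (cases "x = 0")
  case False
  have "x * (\<Prod>y\<in>UNIV-{0}. x * y) = x * x ^ (CARD('k) - 1) * \<Prod>(UNIV-{0})"
    by (simp add: prod.distrib mult_ac card_Diff_subset)
  also have "x * x ^ (CARD('k) - 1) = x ^ CARD('k)"
    by (subst power_Suc [symmetric]) simp
  also have "(\<Prod>y\<in>UNIV-{0}. x * y) = (\<Prod>y\<in>UNIV-{0}. y)"
    by (rule prod.reindex_bij_witness[of _ "\<lambda>y. y / x" "\<lambda>y. x * y"]) (use False in auto)
  finally show ?thesis
    by simp
qed simp

text \<open>Translation by 1 permutes the field, so it leaves the sum of all elements
  unchanged.\<close>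

lemma of_nat_CARD_eq_0: "of_nat CARD('k) = (0 :: 'k::{field,finite})"
proof -
  have "(\<Sum>x\<in>(UNIV::'k set). x + 1) = \<Sum>UNIV"
    by (rule sum.reindex_bij_witness[of _ "\<lambda>x. x - 1" "\<lambda>x. x + 1"]) auto
  then show ?thesis
    by (simp add: sum.distrib)
qed

lemma prime_CHAR_finite_field: "prime CHAR('k::{field,finite})"
  by (intro prime_CHAR_semidom finite_imp_CHAR_pos) simp

lemma CARD_gt_Suc_0: "CARD('k::{field,finite}) > Suc 0"
proof -
  have "card {0, 1 :: 'k} \<le> CARD('k)"
    by (rule card_mono) auto
  then show ?thesis by simp
qed

text \<open>Compare \<open>\<Prod>x \<noteq> 0. t - x\<close> with \<open>t ^ (CARD('k) - 1) - 1\<close> at \<open>t = 0\<close>.\<close>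

lemma prod_nonzero_finite_field: "\<Prod>(UNIV - {0}) = (-1 :: 'k::{field,finite})"
proof -
  let ?N = "CARD('k) - 1"
  let ?f = "\<Prod>x\<in>UNIV - {0::'k}. [:-x, 1:]" and ?g = "monom 1 ?N - 1 :: 'k poly"
  have N: "?N > 0"
    using CARD_gt_Suc_0[where 'k = 'k] by simp
  have cardA: "card (UNIV - {0::'k}) = ?N"
    by (simp add: card_Diff_subset)
  have degf: "degree ?f = ?N"
    by (subst degree_prod_eq_sum_degree) (auto simp: cardA)
  have "lead_coeff ?f = 1"
    by (simp add: lead_coeff_prod)
  then have lf: "coeff ?f ?N = 1"
    by (simp only: degf)
  have "?f = ?g"
  proof (rule poly_eqI_degree_lead_coeff[where n = ?N and A = "UNIV - {0}"])
    show "coeff ?f ?N = coeff ?g ?N"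
      unfolding lf using N by simp
    show "degree ?g \<le> ?N"
      by (intro degree_diff_le) (auto simp: degree_monom_le)
    fix z :: 'k assume z: "z \<in> UNIV - {0}"
    have "z * z ^ ?N = z"
      using power_CARD_eq_self[of z] N by (simp flip: power_Suc)
    with z have "z ^ ?N = 1"
      by simp
    moreover have "poly ?f z = 0"
      using z by (simp add: poly_prod prod_zero_iff)
    ultimately show "poly ?f z = poly ?g z"
      by (simp add: poly_monom)
  qed (simp_all add: degf cardA)
  then have "poly ?f 0 = poly ?g 0"
    by simp
  then have "(\<Prod>x\<in>UNIV - {0::'k}. - x) = -1"
    using N by (simp add: poly_prod poly_monom)
  \<comment> \<open>Negation permutes the nonzero elements, which absorbs the signs without a parity
    argument.\<close>
  moreover have "(\<Prod>x\<in>UNIV - {0::'k}. - x) = \<Prod>(UNIV - {0})"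
    by (rule prod.reindex_bij_witness[of _ uminus uminus]) auto
  ultimately show ?thesis by simp
qed

text \<open>Having too few roots, \<open>t ^ m - 1\<close> is nonzero at some
  \<open>g \<noteq> 0\<close>. Scaling by \<open>g\<close> permutes the terms but multiplies the sum
  by \<open>g ^ m\<close>.\<close>

lemma sum_nonzero_powers_finite_field:
  assumes "0 < m" "m < CARD('k) - 1"
  shows "(\<Sum>x\<in>UNIV - {0}. x ^ m) = (0 :: 'k::{field,finite})"
proof -
  let ?g = "monom 1 m - 1 :: 'k poly"
  have "coeff ?g m \<noteq> 0"
    using assms by simp
  then have g0: "?g \<noteq> 0"
    by force
  have "degree ?g \<le> m"
    by (intro degree_diff_le) (auto simp: degree_monom_le)
  then have "card {x. poly ?g x = 0} < card (UNIV - {0::'k})"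
    using card_poly_roots_bound[OF g0] assms by (simp add: card_Diff_subset)
  then have "\<not> UNIV - {0} \<subseteq> {x. poly ?g x = 0}"
    using card_mono[of "{x. poly ?g x = 0}" "UNIV - {0}"] by auto
  then obtain g :: 'k where g: "g \<noteq> 0" "g ^ m \<noteq> 1"
    by (auto simp: poly_monom)
  have "g ^ m * (\<Sum>x\<in>UNIV - {0}. x ^ m) = (\<Sum>x\<in>UNIV - {0}. (g * x) ^ m)"
    by (simp add: sum_distrib_left power_mult_distrib)
  also have "\<dots> = (\<Sum>x\<in>UNIV - {0}. x ^ m)"
    by (rule sum.reindex_bij_witness[of _ "\<lambda>y. y / g" "\<lambda>y. g * y"]) (use g in auto)
  finally show ?thesis
    using g by simp
qed

section \<open>Polynomials\<close>

text \<open>The coefficient condition describes \<open>{0}\<close> for \<open>d = 0\<close>, where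
  \<open>degree f < d\<close> would give the empty set; so the induction can start there.\<close>

lemma finite_card_polys_degree_less:
  "finite {f :: 'a::{field,finite} poly. \<forall>i\<ge>d. coeff f i = 0} \<and>
   card {f :: 'a poly. \<forall>i\<ge>d. coeff f i = 0} = CARD('a) ^ d"
proof (induction d)
  case 0
  have "{f :: 'a poly. \<forall>i\<ge>0. coeff f i = 0} = {0}"
    by (auto simp: poly_eq_iff)
  then show ?case by simp
next
  case (Suc d)
  let ?B = "\<lambda>d. {f :: 'a poly. \<forall>i\<ge>d. coeff f i = 0}"
  have "?B (Suc d) = (\<lambda>(c, f). pCons c f) ` (UNIV \<times> ?B d)" (is "_ = ?R")
  proof (intro subset_antisym subsetI)
    fix f assume "f \<in> ?B (Suc d)"
    then show "f \<in> ?R"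
      by (cases f) (force simp: coeff_pCons split: nat.splits)
  qed (auto simp: coeff_pCons split: nat.splits)
  moreover have "inj_on (\<lambda>(c, f). pCons c f) (UNIV \<times> ?B d)"
    by (auto simp: inj_on_def)
  ultimately show ?case
    using Suc by (simp add: card_image card_cartesian_product)
qed

lemma polys_degree_less_conv:
  assumes "d > 0"
  shows "{f :: 'a::zero poly. degree f < d} = {f. \<forall>i\<ge>d. coeff f i = 0}"
  using assms by (auto simp: coeff_eq_0 intro: degree_lessI)

lemma degree_pderiv_le: "degree (pderiv f) \<le> degree f - 1"
  by (intro degree_le) (auto simp: coeff_pderiv coeff_eq_0)

lemma pderiv_sum: "pderiv (sum f A) = (\<Sum>x\<in>A. pderiv (f x))"
  by (induction A rule: infinite_finite_induct) (simp_all add: pderiv_add)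

section \<open>Difference quotients and Lagrange interpolation\<close>

lemma difference_quotient_mult:
  "[:-x, 1:] * difference_quotient x a = a - [:poly a x:]"
proof -
  have "[:-x, 1:] dvd a - [:poly a x:]"
    by (simp add: dvd_iff_poly_eq_0)
  then show ?thesis
    unfolding difference_quotient_def by (rule dvd_mult_div_cancel)
qed

lemma degree_difference_quotient_less:
  assumes "degree a > 0"
  shows "degree (difference_quotient x a) < degree a"
proof (cases "difference_quotient x a = 0")
  case False
  then have "degree ([:-x, 1:] * difference_quotient x a) = 1 + degree (difference_quotient x a)"
    by (subst degree_mult_eq) auto
  moreover have "degree (a - [:poly a x:]) \<le> degree a"
    by (intro degree_diff_le) auto
  ultimately show ?thesis
    by (simp only: difference_quotient_mult)
qed (use assms in simp)

lemma poly_difference_quotient_mult: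
  "(y - x) * poly (difference_quotient x a) y = poly a y - poly a x"
  using arg_cong[OF difference_quotient_mult, of "\<lambda>f. poly f y" x a]
  by (simp add: algebra_simps)

lemma pderiv_eq_difference_quotient:
  "pderiv a = difference_quotient x a + [:-x, 1:] * pderiv (difference_quotient x a)"
  using arg_cong[OF difference_quotient_mult, of pderiv x a]
  by (simp add: pderiv_mult pderiv_diff pderiv_pCons pderiv_smult algebra_simps)

lemma poly_difference_quotient_self:
  "poly (difference_quotient x a) x = poly (pderiv a) x"
  using arg_cong[OF pderiv_eq_difference_quotient, of "\<lambda>f. poly f x" a x] by simp

text \<open>With \<open>b\<close> the difference quotient of \<open>a\<close>, differentiating twice
  gives \<open>a'' = 2 b' + (t - x) b''\<close>.\<close>

lemma poly_pderiv_difference_quotient_self: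
  "2 * poly (pderiv (difference_quotient x a)) x = poly (pderiv (pderiv a)) x"
  using arg_cong[OF pderiv_eq_difference_quotient, of "\<lambda>f. poly (pderiv f) x" a x]
  by (simp add: pderiv_add pderiv_diff pderiv_smult pderiv_pCons)

text \<open>The difference quotient of \<open>g\<close> at a root \<open>x\<close> vanishes at the
  other roots and equals \<open>g'(x)\<close> at \<open>x\<close>, so these quotients form a
  Lagrange basis up to scaling.\<close>

lemma lagrange_interpolation_roots:
  fixes f g :: "'k::field poly"
  assumes "finite A" "card A = degree g" "degree f < degree g"
    and "\<And>x. x \<in> A \<Longrightarrow> poly g x = 0"
    and "\<And>x. x \<in> A \<Longrightarrow> poly (pderiv g) x \<noteq> 0"
  shows "f = (\<Sum>x\<in>A. smult (poly f x / poly (pderiv g) x) (difference_quotient x g))"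
proof (rule poly_eqI_degree[where A = A])
  fix y assume y: "y \<in> A"
  have "(\<Sum>x\<in>A. poly f x / poly (pderiv g) x * poly (difference_quotient x g) y)
      = (\<Sum>x\<in>A. if x = y then poly f y else 0)"
  proof (rule sum.cong)
    fix x assume x: "x \<in> A"
    have "(y - x) * poly (difference_quotient x g) y = 0"
      using x y assms(4) by (simp add: poly_difference_quotient_mult)
    then show "poly f x / poly (pderiv g) x * poly (difference_quotient x g) y
        = (if x = y then poly f y else 0)"
      using assms(5)[OF y] by (auto simp: poly_difference_quotient_self)
  qed simp
  then show "poly f y =
      poly (\<Sum>x\<in>A. smult (poly f x / poly (pderiv g) x) (difference_quotient x g)) y"
    using y assms(1) by (simp add: poly_sum sum.delta')
next
  show "degree (\<Sum>x\<in>A. smult (poly f x / poly (pderiv g) x) (difference_quotient x g)) < card A"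
    unfolding assms(2)
    by (intro degree_sum_less)
      (use assms(3) in \<open>auto intro: le_less_trans[OF degree_smult_le] degree_difference_quotient_less\<close>)
qed (use assms in auto)

section \<open>Reduction at a root\<close>

locale finite_field_root =
  fixes \<iota> :: "'a::{field,finite} \<Rightarrow> 'k::{field,finite}"
    and P :: "'a poly" and \<theta> :: 'k and p n :: nat
  assumes prime: "prime p" and odd: "odd p" and n_pos: "n > 0"
    and CARD_base: "CARD('a) = p ^ n" and CARD_ext: "CARD('k) = CARD('a) ^ degree P"
    and hom_one [simp]: "\<iota> 1 = 1"
    and hom_add: "\<And>x y. \<iota> (x + y) = \<iota> x + \<iota> y"
    and hom_mult: "\<And>x y. \<iota> (x * y) = \<iota> x * \<iota> y"
    and monic: "lead_coeff P = 1" and irred: "irreducible P"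
    and root: "poly (map_poly \<iota> P) \<theta> = 0"
begin

abbreviation PK :: "'k poly" where "PK \<equiv> map_poly \<iota> P"

text \<open>This is reduction modulo \<open>P\<close>, with the residue field realised as
  \<open>'k\<close>.\<close>

definition ev :: "'a poly \<Rightarrow> 'k" where "ev f = poly (map_poly \<iota> f) \<theta>"

lemma hom_zero [simp]: "\<iota> 0 = 0"
  using hom_add[of 0 0] by (metis add_0_left add_right_cancel)

lemma hom_minus: "\<iota> (- x) = - \<iota> x"
  using hom_add[of x "- x"] by (simp add: eq_neg_iff_add_eq_0 add.commute)

lemma hom_diff: "\<iota> (x - y) = \<iota> x - \<iota> y"
  using hom_add[of x "- y"] by (simp add: hom_minus)

lemma hom_power: "\<iota> (x ^ m) = \<iota> x ^ m"
  by (induction m) (simp_all add: hom_mult)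

lemma hom_of_nat: "\<iota> (of_nat m) = of_nat m"
  by (induction m) (simp_all add: hom_add)

lemma hom_nonzero: "x \<noteq> 0 \<Longrightarrow> \<iota> x \<noteq> 0"
  using hom_mult[of x "inverse x"] by auto

lemma map_poly_hom_add: "map_poly \<iota> (f + g) = map_poly \<iota> f + map_poly \<iota> g"
  by (intro poly_eqI) (simp add: coeff_map_poly hom_add)

lemma map_poly_hom_diff: "map_poly \<iota> (f - g) = map_poly \<iota> f - map_poly \<iota> g"
  by (intro poly_eqI) (simp add: coeff_map_poly hom_diff)

lemma map_poly_hom_mult: "map_poly \<iota> (f * g) = map_poly \<iota> f * map_poly \<iota> g"
  by (induction f)
    (simp_all add: map_poly_pCons map_poly_hom_add map_poly_smult hom_mult)

lemma map_poly_hom_power: "map_poly \<iota> (f ^ m) = map_poly \<iota> f ^ m"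
  by (induction m) (simp_all add: map_poly_hom_mult)

lemma map_poly_hom_pderiv: "map_poly \<iota> (pderiv f) = pderiv (map_poly \<iota> f)"
  by (intro poly_eqI) (simp add: coeff_map_poly coeff_pderiv hom_mult hom_of_nat flip: of_nat_Suc)

lemma degree_map_poly_hom: "degree (map_poly \<iota> f) = degree f"
  by (intro degree_map_poly hom_nonzero)

lemmas map_poly_hom = map_poly_hom_add map_poly_hom_diff map_poly_hom_mult map_poly_hom_power
  map_poly_hom_pderiv

lemma ev_hom:
  "ev (f + g) = ev f + ev g" "ev (f - g) = ev f - ev g" "ev (f * g) = ev f * ev g"
  "ev (f ^ m) = ev f ^ m" "ev 0 = 0" "ev 1 = 1"
  by (simp_all add: ev_def map_poly_hom)

lemma ev_prod: "ev (prod g A) = (\<Prod>x\<in>A. ev (g x))"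
  by (induction A rule: infinite_finite_induct) (simp_all add: ev_hom)

lemma ev_sum: "ev (sum g A) = (\<Sum>x\<in>A. ev (g x))"
  by (induction A rule: infinite_finite_induct) (simp_all add: ev_hom)

text \<open>A nonzero polynomial of least degree vanishing at \<open>\<theta>\<close> divides \<open>P\<close>, hence is
  associated with \<open>P\<close>.\<close>

lemma ev_eq_0_iff: "ev f = 0 \<longleftrightarrow> P dvd f"
proof
  have P0: "P \<noteq> 0" "ev P = 0"
    using irred root by (auto simp: ev_def)
  then obtain m where m: "m \<noteq> 0" "ev m = 0"
    and min: "\<And>g. g \<noteq> 0 \<Longrightarrow> ev g = 0 \<Longrightarrow> degree m \<le> degree g"
    using ex_has_least_nat[of "\<lambda>g. g \<noteq> 0 \<and> ev g = 0" P degree] by auto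
  have dvd: "m dvd g" if "ev g = 0" for g
  proof -
    have "ev (g mod m) = 0"
      using that m by (simp add: ev_hom flip: minus_div_mult_eq_mod)
    then have "g mod m = 0"
      using min[of "g mod m"] degree_mod_less[of m g] m(1) by force
    then show ?thesis by auto
  qed
  obtain k where k: "P = m * k"
    using dvd P0 by blast
  have "\<not> m dvd 1"
    using m(2) by (metis dvdE ev_hom(3,6) mult_zero_left zero_neq_one)
  then have "k dvd 1"
    using irreducibleD[OF irred k] by simp
  then have "P dvd m"
    unfolding k by (metis dvd_mult_unit_iff dvd_refl mult_unit_dvd_iff)
  then show "ev f = 0 \<Longrightarrow> P dvd f"
    using dvd dvd_trans by blast
qed (use root in \<open>auto simp: ev_hom ev_def[of P] dvd_def\<close>)

text \<open>For polynomials coming from the small field, this turns congruences modulo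
  \<open>PK\<close> into vanishing at the single root \<open>\<theta>\<close>.\<close>

lemma PK_dvd_map_poly_iff: "PK dvd map_poly \<iota> f \<longleftrightarrow> ev f = 0"
proof
  assume "ev f = 0"
  then show "PK dvd map_poly \<iota> f"
    unfolding ev_eq_0_iff by (auto simp: map_poly_hom)
qed (use root in \<open>auto simp: ev_def\<close>)

lemma ev_eq_0_iff_of_degree_less: "degree f < degree P \<Longrightarrow> ev f = 0 \<longleftrightarrow> f = 0"
  unfolding ev_eq_0_iff using dvd_imp_degree_le[of P f] by auto

lemma degree_P_pos: "degree P > 0"
proof (rule ccontr)
  assume "\<not> degree P > 0"
  then have "P dvd 1"
    using monic by (auto elim!: degree_eq_zeroE simp: one_pCons)
  with irred show False
    by (simp add: irreducible_def)
qed

section \<open>Characteristic and Frobenius maps\<close>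

lemma CHAR_ext: "CHAR('k) = p"
proof -
  have "CHAR('k) dvd p ^ (n * degree P)"
    using of_nat_CARD_eq_0[where 'k = 'k]
    by (simp only: of_nat_eq_0_iff_char_dvd CARD_ext CARD_base power_mult)
  then have "CHAR('k) dvd p"
    using prime_CHAR_finite_field[where 'k = 'k] prime_dvd_power by blast
  then show ?thesis
    using prime_CHAR_finite_field[where 'k = 'k] prime primes_dvd_imp_eq by blast
qed

lemma two_nonzero: "(2 :: 'k) \<noteq> 0"
proof
  assume "(2 :: 'k) = 0"
  then have "of_nat 2 = (0 :: 'k)"
    by simp
  then have "p dvd 2"
    by (simp only: of_nat_eq_0_iff_char_dvd CHAR_ext)
  then show False
    using prime odd primes_dvd_imp_eq[of p 2] by auto
qed

lemma add_power_CARD_base_power: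
  "(x + y :: 'k) ^ (CARD('a) ^ i) = x ^ (CARD('a) ^ i) + y ^ (CARD('a) ^ i)"
  by (rule freshmans_dream'[where n = "n * i"])
    (simp_all add: CHAR_ext prime CARD_base power_mult)

lemma add_power_CARD_ext_poly: "(f + g :: 'k poly) ^ CARD('k) = f ^ CARD('k) + g ^ CARD('k)"
  by (rule freshmans_dream'[where n = "n * degree P"])
    (simp_all add: CHAR_ext prime CARD_base CARD_ext power_mult)

lemma hom_power_CARD_base_power: "\<iota> c ^ (CARD('a) ^ i) = \<iota> c"
proof (induction i)
  case (Suc i)
  then show ?case
    by (simp add: power_mult power_CARD_eq_self flip: hom_power)
qed simp

text \<open>The Frobenius power is additive and fixes the coefficients, so it only moves
  \<open>\<theta>\<close> to a conjugate.\<close>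

lemma ev_power_CARD_base_power:
  "ev f ^ (CARD('a) ^ i) = poly (map_poly \<iota> f) (\<theta> ^ (CARD('a) ^ i))"
  unfolding ev_def
  by (induction f)
    (simp_all add: map_poly_pCons add_power_CARD_base_power power_mult_distrib
      hom_power_CARD_base_power power_0_left)

section \<open>Fermat quotients\<close>

lemma ev_Fermat: "ev (f ^ CARD('k) - f) = 0"
  by (simp add: ev_hom power_CARD_eq_self)

text \<open>The quotient stays over the small field, so \<open>PK_dvd_map_poly_iff\<close> applies
  to it.\<close>

lemma fermat_quotient_map_poly:
  "fermat_quotient \<iota> P (map_poly \<iota> f) = map_poly \<iota> ((f ^ CARD('k) - f) div P)"
proof -
  have P0: "PK \<noteq> 0"
    using irred degree_map_poly_hom[of P] degree_P_pos by auto
  have "f ^ CARD('k) - f = P * ((f ^ CARD('k) - f) div P)"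
    using ev_Fermat by (simp add: ev_eq_0_iff)
  then have "map_poly \<iota> f ^ CARD('k) - map_poly \<iota> f = PK * map_poly \<iota> ((f ^ CARD('k) - f) div P)"
    by (metis map_poly_hom(2,3,4))
  then show ?thesis
    using P0 by (simp add: fermat_quotient_def CARD_ext)
qed

abbreviation (input) R :: "'k poly" where "R \<equiv> fermat_quotient \<iota> P [:0, 1:]"

lemma PK_mult_R: "PK * R = [:0, 1:] ^ CARD('k) - [:0, 1:]"
proof -
  have X: "map_poly \<iota> [:0, 1:] = [:0, 1:]"
    by (simp add: map_poly_pCons)
  have "PK dvd [:0, 1:] ^ CARD('k) - [:0, 1:]"
    using PK_dvd_map_poly_iff[of "[:0, 1:] ^ CARD('k) - [:0, 1:]"] ev_Fermat[of "[:0, 1:]"]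
    by (simp only: map_poly_hom X)
  then show ?thesis
    by (simp add: fermat_quotient_def CARD_ext)
qed

lemma pderiv_PK_mult_R: "pderiv PK * R + PK * pderiv R = -1"
proof -
  have "pderiv (PK * R) = -1"
    unfolding PK_mult_R
    by (simp add: pderiv_diff pderiv_power pderiv_pCons of_nat_CARD_eq_0 one_pCons)
  then show ?thesis
    by (simp add: pderiv_mult algebra_simps)
qed

text \<open>At a root of \<open>PK\<close> the preceding identity says that the two values have
  product -1.\<close>

lemma poly_pderiv_PK_nonzero: "poly (pderiv PK) x \<noteq> 0" and poly_R_nonzero: "poly R x \<noteq> 0"
  if "poly PK x = 0"
  using arg_cong[OF pderiv_PK_mult_R, of "\<lambda>f. poly f x"] that by auto

text \<open>Differentiating \<open>\<wp> R = t ^ (q ^ d) - t\<close> twice.\<close>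

lemma poly_pderiv_R_eq_0_iff:
  "poly (pderiv R) \<theta> = 0 \<longleftrightarrow> poly (pderiv (pderiv PK)) \<theta> = 0"
proof -
  have "pderiv (pderiv PK * R + PK * pderiv R) = 0"
    unfolding pderiv_PK_mult_R by (simp add: pderiv_minus)
  then have "poly (pderiv (pderiv PK * R + PK * pderiv R)) \<theta> = 0"
    by simp
  then have "2 * poly (pderiv PK) \<theta> * poly (pderiv R) \<theta>
      = - (poly (pderiv (pderiv PK)) \<theta> * poly R \<theta>)"
    using root by (simp add: pderiv_add pderiv_mult algebra_simps eq_neg_iff_add_eq_0)
  then show ?thesis
    using poly_pderiv_PK_nonzero[OF root] poly_R_nonzero[OF root] two_nonzero
    by (metis mult_eq_0_iff neg_equal_0_iff_equal)
qed

text \<open>Taylor expansion: \<open>a ^ (q ^ d)\<close> is \<open>a\<close> evaluated at \<open>t ^ (q ^ d)\<close>.\<close>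

lemma power_CARD_ext_expansion:
  fixes a T :: "'k poly"
  defines "T \<equiv> [:0, 1:] ^ CARD('k) - [:0, 1:]"
  shows "\<exists>g. a ^ CARD('k) = a + pderiv a * T + T ^ 2 * g"
proof (induction a)
  case (pCons c a)
  then obtain g where g: "a ^ CARD('k) = a + pderiv a * T + T ^ 2 * g"
    by blast
  define X :: "'k poly" where "X = [:0, 1:]"
  have XT: "X ^ CARD('k) = X + T"
    by (simp add: X_def T_def)
  have ca: "pCons c a = [:c:] + X * a"
    by (simp add: X_def)
  have da: "pderiv (pCons c a) = a + X * pderiv a"
    by (simp add: X_def pderiv_pCons)
  have dXa: "pderiv (X * a + [:c:]) = a + X * pderiv a"
    using da by (simp only: ca add.commute)
  have "pCons c a ^ CARD('k) = [:c:] ^ CARD('k) + X ^ CARD('k) * a ^ CARD('k)"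
    unfolding ca by (simp add: add_power_CARD_ext_poly power_mult_distrib)
  also have "[:c:] ^ CARD('k) = [:c:]"
    by (simp add: poly_const_pow power_CARD_eq_self)
  also have "X ^ CARD('k) * a ^ CARD('k) = (X + T) * (a + pderiv a * T + T ^ 2 * g)"
    by (simp only: XT g)
  \<comment> \<open>The last cofactor collects the terms of
    \<open>(X + T) * (a + pderiv a * T + T ^ 2 * g)\<close> that contain
    \<open>T ^ 2\<close>.\<close>
  finally have "pCons c a ^ CARD('k)
      = pCons c a + pderiv (pCons c a) * T + T ^ 2 * (X * g + pderiv a + T * g)"
    unfolding ca by (simp add: dXa algebra_simps power2_eq_square)
  then show ?case by blast
qed (auto simp: power_0_left)

text \<open>In the Taylor expansion \<open>T = PK * R\<close>; dividing by \<open>PK\<close> leaves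
  \<open>pderiv a * R\<close> plus a multiple of \<open>PK\<close>.\<close>

lemma poly_fermat_quotient_root:
  "poly (fermat_quotient \<iota> P a) \<theta> = poly (pderiv a) \<theta> * poly R \<theta>"
proof -
  obtain g where g: "a ^ CARD('k) = a + pderiv a * (PK * R) + (PK * R) ^ 2 * g"
    unfolding PK_mult_R using power_CARD_ext_expansion by blast
  have "PK \<noteq> 0"
    using degree_map_poly_hom[of P] degree_P_pos by auto
  moreover have "a ^ CARD('k) - a = PK * (pderiv a * R + PK * R ^ 2 * g)"
    unfolding g by (simp add: algebra_simps power2_eq_square)
  ultimately have "fermat_quotient \<iota> P a = pderiv a * R + PK * R ^ 2 * g"
    unfolding fermat_quotient_def CARD_ext[symmetric] by simp
  then show ?thesis
    using root by simp
qed

section \<open>The Wilson condition\<close>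

text \<open>Injectivity suffices, since both sets have \<open>CARD('a) ^ degree P\<close>
  elements.\<close>

lemma bij_betw_ev: "bij_betw ev {f. degree f < degree P} UNIV"
proof -
  let ?B = "{f. degree f < degree P}"
  have "inj_on ev ?B"
  proof (rule inj_onI)
    fix f g assume "f \<in> ?B" "g \<in> ?B" "ev f = ev g"
    then have "ev (f - g) = 0" "degree (f - g) < degree P"
      by (simp_all add: ev_hom degree_diff_less)
    then show "f = g"
      by (simp add: ev_eq_0_iff_of_degree_less)
  qed
  moreover from this have "ev ` ?B = UNIV"
    using finite_card_polys_degree_less[where 'a = 'a, of "degree P"]
    by (intro card_subset_eq)
      (simp_all add: card_image CARD_ext polys_degree_less_conv[OF degree_P_pos])
  ultimately show ?thesis
    by (simp add: bij_betw_def)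
qed

lemma bij_betw_ev_nonzero: "bij_betw ev {f. f \<noteq> 0 \<and> degree f < degree P} (UNIV - {0})"
proof -
  have "bij_betw ev ({f. degree f < degree P} - {0}) (UNIV - {ev 0})"
    using degree_P_pos by (intro bij_betw_DiffI bij_betw_ev) (auto simp: bij_betw_def)
  moreover have "{f :: 'a poly. degree f < degree P} - {0} = {f. f \<noteq> 0 \<and> degree f < degree P}"
    by auto
  ultimately show ?thesis
    by (simp only: ev_hom)
qed

text \<open>A coincidence would make a Frobenius power with exponent \<open>0 < m < degree P\<close>
  fix \<open>\<theta>\<close>, hence all of \<open>'k\<close>, giving \<open>t ^ (q ^ m) - t\<close>
  too many roots.\<close>

lemma inj_on_conjugates: "inj_on (\<lambda>i. \<theta> ^ (CARD('a) ^ i)) {..<degree P}"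
proof (rule linorder_inj_onI)
  fix i j :: nat assume "i < j" "i \<in> {..<degree P}" "j \<in> {..<degree P}"
  show "\<theta> ^ (CARD('a) ^ i) \<noteq> \<theta> ^ (CARD('a) ^ j)"
  proof
    assume eq: "\<theta> ^ (CARD('a) ^ i) = \<theta> ^ (CARD('a) ^ j)"
    \<comment> \<open>Raising both sides to the power \<open>q ^ (degree P - j)\<close> turns the
      right one into \<open>\<theta> ^ CARD('k) = \<theta>\<close>.\<close>
    define m where "m = degree P - j + i"
    have m: "m < degree P"
      using \<open>i < j\<close> \<open>j \<in> _\<close> by (simp add: m_def)
    have "\<theta> ^ (CARD('a) ^ m) = (\<theta> ^ (CARD('a) ^ i)) ^ (CARD('a) ^ (degree P - j))"
      by (simp add: m_def power_add mult.commute flip: power_mult)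
    also have "\<dots> = (\<theta> ^ (CARD('a) ^ j)) ^ (CARD('a) ^ (degree P - j))"
      by (simp only: eq)
    also have "\<dots> = \<theta> ^ CARD('k)"
      using \<open>j \<in> _\<close> by (simp add: CARD_ext flip: power_mult power_add)
    finally have \<theta>: "\<theta> ^ (CARD('a) ^ m) = \<theta>"
      by (simp add: power_CARD_eq_self)
    have *: "x ^ (CARD('a) ^ m) = x" for x :: 'k
    proof -
      obtain f where "x = ev f"
        using bij_betw_ev by (metis UNIV_I bij_betw_imp_surj_on imageE)
      then show ?thesis
        using ev_power_CARD_base_power[of f m] by (simp add: \<theta> ev_def)
    qed
    have less: "CARD('a) ^ m < CARD('k)"
      unfolding CARD_ext using CARD_gt_Suc_0[where 'k = 'a] m
      by (intro power_strict_increasing) auto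
    let ?g = "monom 1 (CARD('a) ^ m) - [:0, 1:] :: 'k poly"
    have one: "CARD('a) ^ m \<ge> 1"
      by simp
    have "?g = 0"
    proof (rule poly_eqI_degree[where A = UNIV])
      have "degree ?g \<le> CARD('a) ^ m"
        using one by (intro degree_diff_le) (auto simp: degree_monom_le)
      then show "degree ?g < card (UNIV :: 'k set)"
        using less by simp
    qed (use less in \<open>simp_all add: poly_monom *\<close>)
    then have "monom 1 (CARD('a) ^ m) = (monom 1 1 :: 'k poly)"
      by (simp add: monom_altdef)
    then have "CARD('a) ^ m = 1"
      by (metis degree_monom_eq zero_neq_one)
    then have m0: "m = 0"
      using CARD_gt_Suc_0[where 'k = 'a] by simp
    then show False
      using \<open>i < j\<close> \<open>j \<in> _\<close> by (simp add: m_def)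
  qed
qed auto

lemma conjugate_root: "poly PK (\<theta> ^ (CARD('a) ^ i)) = 0"
  using ev_power_CARD_base_power[of P i] root by (simp add: ev_def power_0_left)

text \<open>As \<open>1 / a(\<theta>)\<close> is summed against the additive polynomial expressing \<open>a'(\<theta>)\<close> in terms of
  \<open>a(\<theta>)\<close>, only its linear coefficient survives.\<close>

lemma sum_logarithmic_derivatives:
  "(\<Sum>f | f \<noteq> 0 \<and> degree f < degree P. ev (pderiv f) / ev f)
     = - (poly (pderiv (difference_quotient \<theta> PK)) \<theta> / poly (pderiv PK) \<theta>)"
proof -
  let ?q = "CARD('a)" and ?B = "{f. f \<noteq> 0 \<and> degree f < degree P}"
  define \<phi> where "\<phi> i = \<theta> ^ (?q ^ i)" for i
  \<comment> \<open>The derivative at \<open>\<theta>\<close> of the Lagrange basis polynomial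
    belonging to the conjugate \<open>\<phi> i\<close>.\<close>
  define c where "c i = poly (pderiv (difference_quotient (\<phi> i) PK)) \<theta> / poly (pderiv PK) (\<phi> i)" for i
  have \<phi>: "inj_on \<phi> {..<degree P}"
    unfolding \<phi>_def by (rule inj_on_conjugates)
  have ev_pderiv: "ev (pderiv f) = (\<Sum>i<degree P. c i * ev f ^ (?q ^ i))" if "degree f < degree P" for f
  proof -
    have "map_poly \<iota> f = (\<Sum>x\<in>\<phi> ` {..<degree P}.
        smult (poly (map_poly \<iota> f) x / poly (pderiv PK) x) (difference_quotient x PK))"
      using that \<phi> poly_pderiv_PK_nonzero conjugate_root
      by (intro lagrange_interpolation_roots) (auto simp: card_image degree_map_poly_hom, auto simp: \<phi>_def)
    also have "\<dots> = (\<Sum>i<degree P.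
        smult (ev f ^ (?q ^ i) / poly (pderiv PK) (\<phi> i)) (difference_quotient (\<phi> i) PK))"
      by (simp add: sum.reindex[OF \<phi>] ev_power_CARD_base_power flip: \<phi>_def)
    finally have "pderiv (map_poly \<iota> f) = (\<Sum>i<degree P.
        smult (ev f ^ (?q ^ i) / poly (pderiv PK) (\<phi> i)) (pderiv (difference_quotient (\<phi> i) PK)))"
      by (simp add: pderiv_sum pderiv_smult)
    then show ?thesis
      by (simp add: ev_def[of "pderiv f"] map_poly_hom poly_sum c_def mult.commute)
  qed
  have "(\<Sum>f\<in>?B. ev (pderiv f) / ev f) = (\<Sum>f\<in>?B. (\<Sum>i<degree P. c i * ev f ^ (?q ^ i)) / ev f)"
    by (simp add: ev_pderiv)
  also have "\<dots> = (\<Sum>x\<in>UNIV - {0}. (\<Sum>i<degree P. c i * x ^ (?q ^ i)) / x)"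
    by (rule sum.reindex_bij_betw[OF bij_betw_ev_nonzero])
  also have "\<dots> = (\<Sum>x\<in>UNIV - {0}. (\<Sum>i<degree P. c i * x ^ (?q ^ i - 1)))"
    by (intro sum.cong) (auto simp: sum_divide_distrib power_diff)
  also have "\<dots> = (\<Sum>i<degree P. c i * (\<Sum>x\<in>UNIV - {0}. x ^ (?q ^ i - 1)))"
    by (subst sum.swap) (simp add: sum_distrib_left)
  also have "\<dots> = (\<Sum>i<degree P. if i = 0 then - c 0 else 0)"
  proof (rule sum.cong)
    fix i assume i: "i \<in> {..<degree P}"
    show "c i * (\<Sum>x\<in>UNIV - {0}. x ^ (?q ^ i - 1)) = (if i = 0 then - c 0 else 0)"
    \<comment> \<open>For \<open>i = 0\<close> the sum counts the nonzero elements, giving -1;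
      otherwise the exponent lies strictly between 0 and \<open>CARD('k) - 1\<close>.\<close>
    proof (cases "i = 0")
      case True
      then show ?thesis
        by (simp add: card_Diff_subset of_nat_diff of_nat_CARD_eq_0)
    next
      case False
      have "?q ^ 0 < ?q ^ i" "?q ^ i < ?q ^ degree P"
        using False i CARD_gt_Suc_0[where 'k = 'a] by (intro power_strict_increasing; simp)+
      then have "0 < ?q ^ i - 1" "?q ^ i - 1 < CARD('k) - 1"
        unfolding CARD_ext by simp_all
      then show ?thesis
        using False by (simp add: sum_nonzero_powers_finite_field)
    qed
  qed simp
  also have "\<dots> = - c 0"
    using degree_P_pos by (simp add: sum.delta')
  finally show ?thesis
    by (simp add: c_def \<phi>_def)
qed

lemma finite_nonzero_polys: "finite {f :: 'a poly. f \<noteq> 0 \<and> degree f < degree P}"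
  using bij_betw_finite[OF bij_betw_ev_nonzero] by simp

lemma ev_prod_nonzero_polys: "ev (prod_nonzero_polys (degree P)) = -1"
  unfolding prod_nonzero_polys_def ev_prod
  using prod.reindex_bij_betw[OF bij_betw_ev_nonzero, of "\<lambda>x. x"]
  by (simp add: prod_nonzero_finite_field)

text \<open>By the product rule, \<open>F' = F * (\<Sum>f. f' / f)\<close> at
  \<open>\<theta>\<close>, where \<open>F\<close> has the value -1; this cancels the sign of the
  logarithmic sum.\<close>

lemma ev_pderiv_prod_nonzero_polys:
  "ev (pderiv (prod_nonzero_polys (degree P)))
     = poly (pderiv (difference_quotient \<theta> PK)) \<theta> / poly (pderiv PK) \<theta>"
proof -
  let ?B = "{f :: 'a poly. f \<noteq> 0 \<and> degree f < degree P}"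
  have "ev (\<Prod>(?B - {f})) = - (1 / ev f)" if "f \<in> ?B" for f
  proof -
    have "ev f \<noteq> 0"
      using that by (simp add: ev_eq_0_iff_of_degree_less)
    moreover have "ev f * ev (\<Prod>(?B - {f})) = -1"
      using ev_prod_nonzero_polys prod.remove[OF finite_nonzero_polys that, of "\<lambda>x. x"]
      by (simp add: prod_nonzero_polys_def flip: ev_hom)
    ultimately show ?thesis
      by (simp add: field_simps)
  qed
  then have "ev (pderiv (prod_nonzero_polys (degree P))) = - (\<Sum>f\<in>?B. ev (pderiv f) / ev f)"
    by (simp add: prod_nonzero_polys_def pderiv_prod ev_sum ev_hom sum_negf)
  then show ?thesis
    by (simp add: sum_logarithmic_derivatives)
qed

text \<open>Writing \<open>f = P * g\<close>, both sides say that \<open>g\<close> vanishes at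
  \<open>\<theta>\<close>, because \<open>P'\<close> does not.\<close>

lemma P_power2_dvd_iff:
  assumes "ev f = 0"
  shows "P ^ 2 dvd f \<longleftrightarrow> ev (pderiv f) = 0"
proof -
  obtain g where g: "f = P * g"
    using assms by (auto simp: ev_eq_0_iff)
  have "P ^ 2 dvd f \<longleftrightarrow> ev g = 0"
    using irred by (auto simp: g power2_eq_square ev_eq_0_iff)
  moreover have "ev (pderiv f) = ev (pderiv P) * ev g"
    using root by (simp add: g pderiv_mult ev_hom ev_def[of P])
  moreover have "ev (pderiv P) \<noteq> 0"
    using poly_pderiv_PK_nonzero[OF root] by (simp add: ev_def map_poly_hom)
  ultimately show ?thesis by simp
qed

lemma wilson_prime_iff: "wilson_prime P \<longleftrightarrow> poly (pderiv (pderiv PK)) \<theta> = 0"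
proof -
  let ?F = "prod_nonzero_polys (degree P) :: 'a poly"
  have "wilson_prime P \<longleftrightarrow> P ^ 2 dvd ?F + 1"
    using monic irred by (simp add: wilson_prime_def cong_iff_dvd_diff)
  also have "\<dots> \<longleftrightarrow> ev (pderiv (?F + 1)) = 0"
    by (rule P_power2_dvd_iff) (simp add: ev_hom ev_prod_nonzero_polys)
  also have "\<dots> \<longleftrightarrow> poly (pderiv (difference_quotient \<theta> PK)) \<theta> = 0"
    using poly_pderiv_PK_nonzero[OF root]
    by (simp add: pderiv_add ev_pderiv_prod_nonzero_polys)
  also have "\<dots> \<longleftrightarrow> poly (pderiv (pderiv PK)) \<theta> = 0"
    using two_nonzero by (simp flip: poly_pderiv_difference_quotient_self)
  finally show ?thesis .
qed

lemma wilson_prime_iff_ev_pderiv2: "wilson_prime P \<longleftrightarrow> ev (pderiv (pderiv P)) = 0"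
  by (simp add: wilson_prime_iff ev_def map_poly_hom)

end

theorem theorem4:
  fixes \<iota> :: "'a::{field,finite} \<Rightarrow> 'k::{field,finite}"
    and P :: "'a poly" and \<theta> :: 'k and p q n d :: nat
  defines "PK \<equiv> map_poly \<iota> P"
    and "Q \<equiv> fermat_quotient \<iota> P"
    and "t \<equiv> [:0, 1:] :: 'k poly"
  assumes "prime p" and "odd p" and "n > 0" and "q = p ^ n"
    and "CARD('a) = q" and "CARD('k) = q ^ d"
    and "\<iota> 1 = 1"
    and "\<And>x y. \<iota> (x + y) = \<iota> x + \<iota> y"
    and "\<And>x y. \<iota> (x * y) = \<iota> x * \<iota> y"
    and "lead_coeff P = 1" and "irreducible P" and "degree P = d"
    and "poly PK \<theta> = 0"
  shows
    "(wilson_prime P \<longleftrightarrow> pderiv (pderiv P) = 0) \<and>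
     (wilson_prime P \<longleftrightarrow> [pderiv (Q t) = 0] (mod PK)) \<and>
     (wilson_prime P \<longleftrightarrow> poly (pderiv (Q t)) \<theta> = 0) \<and>
     (wilson_prime P \<longleftrightarrow> [Q (pderiv PK) = 0] (mod PK)) \<and>
     (wilson_prime P \<longleftrightarrow> poly (Q (pderiv PK)) \<theta> = 0) \<and>
     (wilson_prime P \<longleftrightarrow> poly (pderiv (difference_quotient \<theta> PK)) \<theta> = 0) \<and>
     (wilson_prime P \<longleftrightarrow> poly (difference_quotient \<theta> (pderiv PK)) \<theta> = 0) \<and>
     (wilson_prime P \<longleftrightarrow> poly (Q (difference_quotient \<theta> PK)) \<theta> = 0) \<and>
     (wilson_prime P \<longleftrightarrow> poly (difference_quotient \<theta> (Q t)) \<theta> = 0)"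
proof -
  interpret finite_field_root \<iota> P \<theta> p n
    by unfold_locales (use assms in \<open>simp_all add: PK_def\<close>)
  note W = wilson_prime_iff
  have t: "t = map_poly \<iota> [:0, 1:]"
    by (simp add: t_def map_poly_pCons)
  \<comment> \<open>The second derivative has degree below \<open>degree P\<close>, so it vanishes
    at \<open>\<theta>\<close> only if it is zero.\<close>
  have c1: "wilson_prime P \<longleftrightarrow> pderiv (pderiv P) = 0"
    unfolding wilson_prime_iff_ev_pderiv2
    using degree_pderiv_le[of "pderiv P"] degree_pderiv_le[of P] degree_P_pos
    by (intro ev_eq_0_iff_of_degree_less) linarith
  have c3: "wilson_prime P \<longleftrightarrow> poly (pderiv (Q t)) \<theta> = 0"
    by (simp add: W Q_def t_def poly_pderiv_R_eq_0_iff)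
  have c2: "[pderiv (Q t) = 0] (mod PK) \<longleftrightarrow> poly (pderiv (Q t)) \<theta> = 0"
    unfolding Q_def t fermat_quotient_map_poly PK_def cong_0_iff
    by (simp only: PK_dvd_map_poly_iff ev_def flip: map_poly_hom_pderiv)
  have c5: "wilson_prime P \<longleftrightarrow> poly (Q (pderiv PK)) \<theta> = 0"
    using poly_R_nonzero[OF root] by (simp add: W Q_def PK_def poly_fermat_quotient_root[of "pderiv _"])
  have c4: "[Q (pderiv PK) = 0] (mod PK) \<longleftrightarrow> poly (Q (pderiv PK)) \<theta> = 0"
    unfolding Q_def PK_def cong_0_iff map_poly_hom_pderiv[symmetric] fermat_quotient_map_poly
    by (simp only: PK_dvd_map_poly_iff ev_def)
  have c6: "wilson_prime P \<longleftrightarrow> poly (pderiv (difference_quotient \<theta> PK)) \<theta> = 0"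
    using two_nonzero by (simp add: W PK_def flip: poly_pderiv_difference_quotient_self)
  have c7: "wilson_prime P \<longleftrightarrow> poly (difference_quotient \<theta> (pderiv PK)) \<theta> = 0"
    by (simp add: W PK_def poly_difference_quotient_self)
  \<comment> \<open>At \<open>\<theta>\<close> the Fermat quotient is the derivative times a nonzero
    constant, which reduces this to \<open>c6\<close>.\<close>
  have c8: "wilson_prime P \<longleftrightarrow> poly (Q (difference_quotient \<theta> PK)) \<theta> = 0"
    unfolding c6 using poly_R_nonzero[OF root] by (simp add: Q_def poly_fermat_quotient_root[of "difference_quotient _ _"])
  have c9: "wilson_prime P \<longleftrightarrow> poly (difference_quotient \<theta> (Q t)) \<theta> = 0"
    unfolding c3 by (simp add: poly_difference_quotient_self)
  show ?thesis
    using c1 c2 c3 c4 c5 c6 c7 c8 c9 by blast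
qed

end
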